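(* Let $\Delta$ be a thick building of purely infinite type (not necessarily of finite rank), with set of chambers $\mathcal{C}$ and gallery metric $d$, and let $\phi$ be a nontrivial automorphism of $\Delta$ (not necessarily type-preserving). Then $\phi$, viewed as an isometry of $(\mathcal{C},d)$, has unbounded displacement, i.e., the set $\{d(C,\phi(C)) \mid C\in\mathcal{C}\}$ is unbounded.
   Context: A building $\Delta$ with Weyl group $(W,S)$, where $(W,S)$ is a Coxeter system ($S$ possibly infinite) with length function $l$, is described by a nonempty set $\mathcal{C}$ of chambers and a Weyl distance function $\delta\colon\mathcal{C}\times\mathcal{C}\to W$ such that for all $C,D\in\mathcal{C}$: (1) $\delta(C,D)=1$ iff $C=D$; (2) if $\delta(C,D)=w$ and $C'\in\mathcal{C}$ satisfies $\delta(C',C)=s\in S$, then $\delta(C',D)\in\{sw,w\}$, and if moreover $l(sw)=l(w)+1$ then $\delta(C',D)=sw$; (3) if $\delta(C,D)=w$, then for every $s\in S$ there is $C'\in\mathcal{C}$ with $\delta(C',C)=s$ and $\delta(C',D)=sw$. Chambers $C,D$ are $s$-adjacent if $\delta(C,D)=s$. The building is thick if for every chamber $C$ and every $s\in S$ there are at least two chambers $s$-adjacent to $C$. The gallery metric is $d(C,D)=l(\delta(C,D))$. An automorphism $\phi$ of $\Delta$ (not necessarily type-preserving) is a bijection $\phi\colon\mathcal{C}\to\mathcal{C}$ for which there is an automorphism $\sigma$ of $(W,S)$ (a group automorphism of $W$ with $\sigma(S)=S$) such that $\delta(\phi(C),\phi(D))=\sigma(\delta(C,D))$ for all $C,D\in\mathcal{C}$.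 $\Delta$ is of purely infinite type if every irreducible factor of its Weyl group $(W,S)$ is infinite; the irreducible factors are the Coxeter systems $(\langle S_i\rangle,S_i)$, where the $S_i$ are the vertex sets of the connected components of the Coxeter diagram of $(W,S)$. *)

theory Defs
  imports "HOL-Algebra.Algebra"
begin

text \<open>
  \<open>group.ord W x\<close> is \<open>0\<close> when \<open>x\<close> has infinite order, so \<open>coxeter_m W s t = 0\<close>
  encodes \<open>m(s,t) = \<infinity>\<close>.
\<close>

definition coxeter_m :: "('w, 'm) monoid_scheme \<Rightarrow> 'w \<Rightarrow> 'w \<Rightarrow> nat" where
  "coxeter_m W s t = group.ord W (s \<otimes>\<^bsub>W\<^esub> t)"

definition word_prod :: "('w, 'm) monoid_scheme \<Rightarrow> 'w list \<Rightarrow> 'w" where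
  "word_prod W ws = foldr (\<otimes>\<^bsub>W\<^esub>) ws \<one>\<^bsub>W\<^esub>"

text \<open>
  The congruence on words over \<open>S\<close> generated by the Coxeter relations
  \<open>(s t)\<^bsup>m(s,t)\<^esup> = 1\<close> with \<open>m(s,t)\<close> finite. For \<open>s = t\<close> this is \<open>s s = 1\<close>, so formal
  inverses of generators are not needed, and the quotient of the free monoid on \<open>S\<close> by
  this congruence is the group presented by the Coxeter relations.
\<close>

inductive coxeter_cong :: "('w, 'm) monoid_scheme \<Rightarrow> 'w set \<Rightarrow> 'w list \<Rightarrow> 'w list \<Rightarrow> bool"
  for W :: "('w, 'm) monoid_scheme" and S :: "'w set"
where
  cong_rel: "\<lbrakk>us \<in> lists S; vs \<in> lists S; s \<in> S; t \<in> S; coxeter_m W s t \<noteq> 0\<rbrakk>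
    \<Longrightarrow> coxeter_cong W S (us @ concat (replicate (coxeter_m W s t) [s, t]) @ vs) (us @ vs)"
| cong_refl: "us \<in> lists S \<Longrightarrow> coxeter_cong W S us us"
| cong_sym: "coxeter_cong W S us vs \<Longrightarrow> coxeter_cong W S vs us"
| cong_trans: "\<lbrakk>coxeter_cong W S us vs; coxeter_cong W S vs ws\<rbrakk> \<Longrightarrow> coxeter_cong W S us ws"

locale coxeter_system = group W for W :: "('w, 'm) monoid_scheme" (structure) +
  fixes S :: "'w set"
  assumes gens_carrier: "S \<subseteq> carrier W"
    and gens_order_2: "s \<in> S \<Longrightarrow> ord s = 2"
    and gens_generate: "generate W S = carrier W"
    and presentation:
      "\<lbrakk>us \<in> lists S; vs \<in> lists S; word_prod W us = word_prod W vs\<rbrakk> \<Longrightarrow> coxeter_cong W S us vs"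
begin

definition len :: "'w \<Rightarrow> nat" where
  "len w = (LEAST n. \<exists>ws \<in> lists S. length ws = n \<and> word_prod W ws = w)"

definition diagram_edges :: "('w \<times> 'w) set" where
  "diagram_edges =
    {(s, t). s \<in> S \<and> t \<in> S \<and> s \<noteq> t \<and> (coxeter_m W s t \<ge> 3 \<or> coxeter_m W s t = 0)}"

definition diagram_components :: "'w set set" where
  "diagram_components = {{t. (s, t) \<in> diagram_edges\<^sup>*} | s. s \<in> S}"

definition purely_infinite :: bool where
  "purely_infinite \<longleftrightarrow> (\<forall>J \<in> diagram_components. infinite (generate W J))"

definition system_automorphisms :: "('w \<Rightarrow> 'w) set" where
  "system_automorphisms = {\<sigma> \<in> iso W W. \<sigma> ` S = S}"

end


locale building = coxeter_system W S
  for W :: "('w, 'm) monoid_scheme" (structure) and S :: "'w set" +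
  fixes chambers :: "'c set" and \<delta> :: "'c \<Rightarrow> 'c \<Rightarrow> 'w"
  assumes chambers_nonempty: "chambers \<noteq> {}"
    and delta_closed: "\<lbrakk>C \<in> chambers; D \<in> chambers\<rbrakk> \<Longrightarrow> \<delta> C D \<in> carrier W"
    and delta_eq_one_iff: "\<lbrakk>C \<in> chambers; D \<in> chambers\<rbrakk> \<Longrightarrow> \<delta> C D = \<one> \<longleftrightarrow> C = D"
    and delta_adjacent:
      "\<lbrakk>C \<in> chambers; D \<in> chambers; C' \<in> chambers; s \<in> S; \<delta> C' C = s\<rbrakk>
        \<Longrightarrow> \<delta> C' D \<in> {s \<otimes> \<delta> C D, \<delta> C D}"
    and delta_adjacent_up:
      "\<lbrakk>C \<in> chambers; D \<in> chambers; C' \<in> chambers; s \<in> S; \<delta> C' C = s;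
        len (s \<otimes> \<delta> C D) = len (\<delta> C D) + 1\<rbrakk>
        \<Longrightarrow> \<delta> C' D = s \<otimes> \<delta> C D"
    and delta_adjacent_exists:
      "\<lbrakk>C \<in> chambers; D \<in> chambers; s \<in> S\<rbrakk>
        \<Longrightarrow> \<exists>C' \<in> chambers. \<delta> C' C = s \<and> \<delta> C' D = s \<otimes> \<delta> C D"
begin

definition adjacent :: "'w \<Rightarrow> 'c \<Rightarrow> 'c \<Rightarrow> bool" where
  "adjacent s C D \<longleftrightarrow> \<delta> C D = s"

definition thick :: bool where
  "thick \<longleftrightarrow> (\<forall>C \<in> chambers. \<forall>s \<in> S.
    \<exists>D \<in> chambers. \<exists>E \<in> chambers. D \<noteq> E \<and> adjacent s C D \<and> adjacent s C E)"

definition gallery_dist :: "'c \<Rightarrow> 'c \<Rightarrow> nat" where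
  "gallery_dist C D = len (\<delta> C D)"

text \<open>
  Only the restriction of \<open>\<phi>\<close> to the chambers
  is relevant; its values elsewhere are arbitrary.
\<close>

definition automorphism :: "('c \<Rightarrow> 'c) \<Rightarrow> bool" where
  "automorphism \<phi> \<longleftrightarrow> bij_betw \<phi> chambers chambers \<and>
    (\<exists>\<sigma> \<in> system_automorphisms.
      \<forall>C \<in> chambers. \<forall>D \<in> chambers. \<delta> (\<phi> C) (\<phi> D) = \<sigma> (\<delta> C D))"

definition nontrivial :: "('c \<Rightarrow> 'c) \<Rightarrow> bool" where
  "nontrivial \<phi> \<longleftrightarrow> (\<exists>C \<in> chambers. \<phi> C \<noteq> C)"

end

end

theory Submission
  imports Defs
begin

text \<open>
  Suppose the displacement is bounded and is maximal at \<open>C\<close>, and put \<open>w = \<delta> C (\<phi> C) \<noteq> 1\<close>.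
  Moving \<open>C\<close> inside its \<open>s\<close>-panel and using thickness, maximality forces for every generator
  \<open>s\<close> either \<open>l(sw) < l(w)\<close> or \<open>sw = w\<sigma>(s)\<close>. Let \<open>J\<close> be the (nonempty) set of left descents of
  \<open>w\<close> and \<open>K = S - J\<close>. For \<open>v \<in> W\<^sub>K\<close> the element \<open>vw\<close> still has all of \<open>J\<close> as left descents, so
  by the exchange condition the set \<open>R\<close> of reflections \<open>v\<^sup>-\<^sup>1sv\<close> with \<open>s \<in> J\<close>, \<open>v \<in> W\<^sub>K\<close> is finite.
  Let \<open>N\<close> be the kernel of the conjugation action of \<open>W\<^sub>K\<close> on \<open>R\<close>, and \<open>L \<subseteq> K\<close> the set of letters
  of its elements. Normality of \<open>N\<close> makes \<open>L\<close> commute with \<open>S - L\<close>. As \<open>W\<^bsub>K-L\<^esub>\<close> acts faithfully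
  on \<open>R\<close>, it is finite; if \<open>v\<close> is its longest element, then every element of \<open>S - L\<close> is a left
  descent of \<open>vw\<close>, so \<open>W\<^bsub>S-L\<^esub>\<close> is finite. It contains an irreducible factor, since \<open>J \<subseteq> S - L\<close>.
\<close>

section \<open>The exchange condition\<close>

text \<open>
  For \<open>ws = s\<^sub>1 \<dots> s\<^sub>n\<close>, whether \<open>r\<close> occurs an odd number of times among the elements
  \<open>s\<^sub>1 \<dots> s\<^sub>i \<dots> s\<^sub>1\<close>, \<open>i = 1, \<dots>, n\<close>. This parity depends only on the product of \<open>ws\<close>.
\<close>

primrec odd_inversion :: "('w, 'm) monoid_scheme \<Rightarrow> 'w list \<Rightarrow> 'w \<Rightarrow> bool" where
  "odd_inversion W [] r = False"
| "odd_inversion W (s # ws) r = ((r = s) \<noteq> odd_inversion W ws (s \<otimes>\<^bsub>W\<^esub> r \<otimes>\<^bsub>W\<^esub> s))"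

definition delete_nth :: "nat \<Rightarrow> 'a list \<Rightarrow> 'a list" where
  "delete_nth i xs = take i xs @ drop (Suc i) xs"

lemma length_delete_nth: "i < length xs \<Longrightarrow> Suc (length (delete_nth i xs)) = length xs"
  by (simp add: delete_nth_def)

lemma delete_nth_in_lists: "xs \<in> lists A \<Longrightarrow> delete_nth i xs \<in> lists A"
  by (auto simp: delete_nth_def dest: in_set_takeD in_set_dropD)

context coxeter_system
begin

section \<open>Products of words in the generators\<close>

lemma gen_closed [simp]: "s \<in> S \<Longrightarrow> s \<in> carrier W"
  using gens_carrier by blast

lemma gen_mult_self [simp]: "s \<in> S \<Longrightarrow> s \<otimes> s = \<one>"
  using pow_ord_eq_1[of s] gens_order_2[of s] by (simp add: numeral_2_eq_2)

lemma gen_mult_cancel [simp]: "s \<in> S \<Longrightarrow> x \<in> carrier W \<Longrightarrow> s \<otimes> (s \<otimes> x) = x"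
  by (simp flip: m_assoc)

lemma gen_mult_cancel_right [simp]: "s \<in> S \<Longrightarrow> x \<in> carrier W \<Longrightarrow> x \<otimes> s \<otimes> s = x"
  by (simp add: m_assoc)

lemma inv_gen [simp]: "s \<in> S \<Longrightarrow> inv s = s"
  by (simp add: inv_equality)

lemma gen_not_one: "s \<in> S \<Longrightarrow> s \<noteq> \<one>"
  using gens_order_2[of s] by auto

lemma word_prod_Nil [simp]: "word_prod W [] = \<one>"
  by (simp add: word_prod_def)

lemma word_prod_Cons [simp]: "word_prod W (x # xs) = x \<otimes> word_prod W xs"
  by (simp add: word_prod_def)

lemma word_prod_closed [simp]: "ws \<in> lists S \<Longrightarrow> word_prod W ws \<in> carrier W"
  by (induction ws) auto

lemma word_prod_append [simp]:
  "us \<in> lists S \<Longrightarrow> vs \<in> lists S \<Longrightarrow> word_prod W (us @ vs) = word_prod W us \<otimes> word_prod W vs"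
  by (induction us) (auto simp: m_assoc)

lemma word_prod_rev: "ws \<in> lists S \<Longrightarrow> word_prod W (rev ws) = inv (word_prod W ws)"
proof (induction ws)
  case (Cons s ws)
  then have "rev ws \<in> lists S" "[s] \<in> lists S" by auto
  with Cons show ?case by (simp add: inv_mult_group)
qed simp

lemma word_prod_replicate:
  assumes "s \<in> S" "t \<in> S"
  shows "word_prod W (concat (replicate n [s, t])) = (s \<otimes> t) [^] n"
proof (induction n)
  case (Suc n)
  have "word_prod W (concat (replicate (Suc n) [s, t])) = s \<otimes> (t \<otimes> (s \<otimes> t) [^] n)"
    using Suc by simp
  also have "\<dots> = (s \<otimes> t) [^] Suc n"
    using assms by (metis gen_closed m_assoc m_closed nat_pow_Suc2 nat_pow_closed)
  finally show ?case .
qed simp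

text \<open>Every generator is its own inverse, so words without formal inverses exhaust the
  subgroup.\<close>

lemma generate_eq_word_prods:
  assumes "K \<subseteq> S"
  shows "generate W K = word_prod W ` lists K"
proof
  have sub: "lists K \<subseteq> lists S" using assms by (rule lists_mono)
  show "generate W K \<subseteq> word_prod W ` lists K"
  proof
    fix x assume "x \<in> generate W K"
    then show "x \<in> word_prod W ` lists K"
    proof induction
      case one
      show ?case by (rule image_eqI[of _ _ "[]"]) auto
    next
      case (incl h)
      then show ?case using assms by (intro image_eqI[of _ _ "[h]"]) auto
    next
      case (inv h)
      then show ?case using assms by (intro image_eqI[of _ _ "[h]"]) auto
    next
      case (eng x y)
      then obtain us vs where "us \<in> lists K" "vs \<in> lists K" "x = word_prod W us" "y = word_prod W vs"
        by blast
      moreover from this sub have "us \<in> lists S" "vs \<in> lists S" by blast+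
      ultimately show ?case by (intro image_eqI[of _ _ "us @ vs"]) auto
    qed
  qed
  show "word_prod W ` lists K \<subseteq> generate W K"
  proof
    fix x assume "x \<in> word_prod W ` lists K"
    then obtain ws where "ws \<in> lists K" "x = word_prod W ws" by blast
    then show "x \<in> generate W K"
      by (induction ws arbitrary: x) (auto intro: generate.intros)
  qed
qed

section \<open>Inversion parity of words\<close>

lemma odd_inversion_append:
  "us \<in> lists S \<Longrightarrow> vs \<in> lists S \<Longrightarrow> r \<in> carrier W \<Longrightarrow>
    odd_inversion W (us @ vs) r =
      (odd_inversion W us r \<noteq> odd_inversion W vs (inv (word_prod W us) \<otimes> r \<otimes> word_prod W us))"
proof (induction us arbitrary: r)
  case (Cons s us)
  then have c: "s \<in> carrier W" "word_prod W us \<in> carrier W" "us \<in> lists S" "s \<in> S" by auto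
  \<comment> \<open>The conjugations by the single letters compose to one conjugation by the whole
    prefix, so the parity is a cocycle on words.\<close>
  have "inv (word_prod W us) \<otimes> (s \<otimes> r \<otimes> s) \<otimes> word_prod W us
    = inv (word_prod W (s # us)) \<otimes> r \<otimes> word_prod W (s # us)"
    using c Cons.prems by (simp add: inv_mult_group m_assoc)
  then show ?case using Cons c by auto
qed simp

text \<open>An odd count is nonzero, so \<open>r = s_1 ... s_i ... s_1\<close> for some
  \<open>i\<close>; multiplying the word by this \<open>r\<close> on the left cancels the letter
  \<open>s_i\<close>.\<close>

lemma odd_inversion_delete:
  "ws \<in> lists S \<Longrightarrow> r \<in> carrier W \<Longrightarrow> odd_inversion W ws r \<Longrightarrow>
    \<exists>i < length ws. r \<otimes> word_prod W ws = word_prod W (delete_nth i ws)"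
proof (induction ws arbitrary: r)
  case (Cons s ws)
  then have c: "s \<in> S" "ws \<in> lists S" by auto
  show ?case
  proof (cases "r = s")
    case True
    then show ?thesis using c by (intro exI[of _ 0]) (auto simp: delete_nth_def)
  next
    case False
    with Cons.prems have "odd_inversion W ws (s \<otimes> r \<otimes> s)" by simp
    from Cons.IH[OF c(2) _ this] Cons.prems c obtain i where i: "i < length ws"
      "s \<otimes> r \<otimes> s \<otimes> word_prod W ws = word_prod W (delete_nth i ws)" by auto
    have "r \<otimes> word_prod W (s # ws) = s \<otimes> (s \<otimes> r \<otimes> s \<otimes> word_prod W ws)"
      using c Cons.prems by (simp add: m_assoc)
    also have "\<dots> = word_prod W (delete_nth (Suc i) (s # ws))"
      using i by (simp add: delete_nth_def)
    finally show ?thesis using i by (intro exI[of _ "Suc i"]) auto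
  qed
qed simp

text \<open>The palindromes \<open>s t s ... s\<close> belonging to the \<open>2n\<close> letters
  are the elements \<open>(st)^i s\<close>, which makes the count for a Coxeter relator
  explicit.\<close>

lemma odd_inversion_alternating:
  assumes "s \<in> S" "t \<in> S"
  shows "r \<in> carrier W \<Longrightarrow> odd_inversion W (concat (replicate n [s, t])) r
    = odd (\<Sum>i<2 * n. of_bool (r = (s \<otimes> t) [^] i \<otimes> s) :: nat)"
proof (induction n arbitrary: r)
  case (Suc n)
  let ?a = "s \<otimes> t"
  have [simp]: "s \<in> carrier W" "t \<in> carrier W" using assms by auto
  \<comment> \<open>Removing the two leading letters conjugates \<open>r\<close> by
    \<open>st\<close> and thereby shifts the exponent by two.\<close>
  have shift: "t \<otimes> (s \<otimes> r \<otimes> s) \<otimes> t = ?a [^] i \<otimes> s \<longleftrightarrow> r = ?a [^] Suc (Suc i) \<otimes> s" for i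
  proof -
    have "?a [^] Suc (Suc i) = ?a \<otimes> (?a [^] i \<otimes> ?a)"
      by (metis \<open>s \<in> carrier W\<close> \<open>t \<in> carrier W\<close> m_closed nat_pow_Suc nat_pow_Suc2)
    then have *: "?a [^] Suc (Suc i) \<otimes> s = s \<otimes> (t \<otimes> (?a [^] i \<otimes> s) \<otimes> t) \<otimes> s"
      by (simp add: m_assoc)
    show ?thesis
    proof
      assume "t \<otimes> (s \<otimes> r \<otimes> s) \<otimes> t = ?a [^] i \<otimes> s"
      then have "?a [^] Suc (Suc i) \<otimes> s = s \<otimes> (t \<otimes> (t \<otimes> (s \<otimes> r \<otimes> s) \<otimes> t) \<otimes> t) \<otimes> s"
        unfolding * by simp
      also have "\<dots> = r" using assms Suc.prems by (simp add: m_assoc)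
      finally show "r = ?a [^] Suc (Suc i) \<otimes> s" by simp
    next
      assume "r = ?a [^] Suc (Suc i) \<otimes> s"
      then show "t \<otimes> (s \<otimes> r \<otimes> s) \<otimes> t = ?a [^] i \<otimes> s"
        unfolding * using assms by (simp add: m_assoc)
    qed
  qed
  have second: "s \<otimes> r \<otimes> s = t \<longleftrightarrow> r = ?a \<otimes> s"
  proof
    assume "s \<otimes> r \<otimes> s = t"
    then have "?a \<otimes> s = s \<otimes> (s \<otimes> r \<otimes> s) \<otimes> s" by simp
    also have "\<dots> = r" using assms Suc.prems by (simp add: m_assoc)
    finally show "r = ?a \<otimes> s" by simp
  next
    assume "r = ?a \<otimes> s"
    then show "s \<otimes> r \<otimes> s = t" using assms by (simp add: m_assoc)
  qed
  have "t \<otimes> (s \<otimes> r \<otimes> s) \<otimes> t \<in> carrier W" using Suc.prems by simp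
  from Suc.IH[OF this] have IH: "odd_inversion W (concat (replicate n [s, t])) (t \<otimes> (s \<otimes> r \<otimes> s) \<otimes> t)
    = odd (\<Sum>i<2 * n. of_bool (r = ?a [^] Suc (Suc i) \<otimes> s) :: nat)"
    by (simp only: shift)
  have "(\<Sum>i<2 * Suc n. of_bool (r = ?a [^] i \<otimes> s) :: nat)
    = of_bool (r = s) + (of_bool (r = ?a \<otimes> s) + (\<Sum>i<2 * n. of_bool (r = ?a [^] Suc (Suc i) \<otimes> s)))"
    by (simp add: sum.lessThan_Suc_shift del: sum.lessThan_Suc)
  then show ?case using IH second by simp
qed simp

text \<open>A relator has even length, trivial product and even inversion counts, so inserting it
  changes neither parity. Through \<open>presentation\<close> both parities become functions of the
  group element.\<close>

lemma coxeter_cong_invariants: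
  assumes "coxeter_cong W S us vs"
  shows "us \<in> lists S \<and> vs \<in> lists S \<and> (even (length us) \<longleftrightarrow> even (length vs)) \<and>
    (\<forall>r \<in> carrier W. odd_inversion W us r \<longleftrightarrow> odd_inversion W vs r)"
  using assms
proof induction
  case (cong_rel us vs s t)
  let ?m = "coxeter_m W s t"
  let ?rel = "concat (replicate ?m [s, t])"
  have rel: "?rel \<in> lists S" using cong_rel by auto
  have pow: "(s \<otimes> t) [^] ?m = \<one>"
    using cong_rel by (simp add: coxeter_m_def pow_ord_eq_1)
  have one: "word_prod W ?rel = \<one>" using word_prod_replicate cong_rel pow by simp
  \<comment> \<open>the \<open>2m\<close> elements \<open>(st)\<^sup>i s\<close> attached to the relator repeat with period \<open>m\<close>\<close>
  have no: "\<not> odd_inversion W ?rel r" if "r \<in> carrier W" for r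
  proof -
    let ?f = "\<lambda>i. of_bool (r = (s \<otimes> t) [^] i \<otimes> s) :: nat"
    have per: "?f (?m + i) = ?f i" for i
      using cong_rel pow by (simp flip: nat_pow_mult)
    have split: "(\<Sum>i<m + n. g i) = (\<Sum>i<m. g i) + (\<Sum>i<n. g (m + i))" for g :: "nat \<Rightarrow> nat" and m n
      by (induction n) simp_all
    have "(\<Sum>i<2 * ?m. ?f i) = (\<Sum>i<?m. ?f i) + (\<Sum>i<?m. ?f (?m + i))"
      unfolding mult_2 by (rule split)
    also have "\<dots> = 2 * (\<Sum>i<?m. ?f i)" by (simp only: per mult_2)
    finally show ?thesis using odd_inversion_alternating[of s t r ?m] cong_rel that by simp
  qed
  have "even (length ?rel)" by (simp add: length_concat sum_list_replicate)
  moreover have "odd_inversion W (us @ ?rel @ vs) r \<longleftrightarrow> odd_inversion W (us @ vs) r"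
    if "r \<in> carrier W" for r
    using that cong_rel rel one no by (simp add: odd_inversion_append)
  ultimately show ?case using cong_rel rel by auto
qed auto


section \<open>Word length\<close>

lemma word_prod_surj:
  assumes "w \<in> carrier W"
  obtains ws where "ws \<in> lists S" "word_prod W ws = w"
proof -
  from assms have "w \<in> word_prod W ` lists S"
    using generate_eq_word_prods[OF subset_refl] gens_generate by simp
  then show ?thesis using that by blast
qed

lemma len_le_length: "ws \<in> lists S \<Longrightarrow> len (word_prod W ws) \<le> length ws"
  unfolding len_def by (rule Least_le) blast

lemma reduced_word:
  assumes "w \<in> carrier W"
  obtains ws where "ws \<in> lists S" "length ws = len w" "word_prod W ws = w"
proof -
  from word_prod_surj[OF assms] obtain us where "us \<in> lists S" "word_prod W us = w" .
  then have "\<exists>n. \<exists>ws\<in>lists S. length ws = n \<and> word_prod W ws = w" by blast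
  from LeastI_ex[OF this] show ?thesis unfolding len_def[symmetric] using that by blast
qed

lemma even_len_word_prod: "ws \<in> lists S \<Longrightarrow> even (len (word_prod W ws)) \<longleftrightarrow> even (length ws)"
proof -
  assume ws: "ws \<in> lists S"
  obtain us where us: "us \<in> lists S" "length us = len (word_prod W ws)" "word_prod W us = word_prod W ws"
    using word_prod_closed[OF ws] by (rule reduced_word)
  from coxeter_cong_invariants[OF presentation[OF us(1) ws us(3)]] us(2) show ?thesis by simp
qed

lemma len_mult_le:
  assumes "x \<in> carrier W" "y \<in> carrier W"
  shows "len (x \<otimes> y) \<le> len x + len y"
proof -
  obtain us where us: "us \<in> lists S" "length us = len x" "word_prod W us = x"
    using assms(1) by (rule reduced_word)
  obtain vs where vs: "vs \<in> lists S" "length vs = len y" "word_prod W vs = y"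
    using assms(2) by (rule reduced_word)
  show ?thesis using len_le_length[of "us @ vs"] us vs by auto
qed

lemma len_one [simp]: "len \<one> = 0"
  using len_le_length[of "[]"] by simp

lemma len_eq_0_iff: "w \<in> carrier W \<Longrightarrow> len w = 0 \<longleftrightarrow> w = \<one>"
  by (metis len_one length_0_conv reduced_word[of w] word_prod_Nil)

lemma len_gen: "s \<in> S \<Longrightarrow> len s = 1"
  using len_le_length[of "[s]"] len_eq_0_iff[of s] gen_not_one[of s] by fastforce

lemma len_inv: "w \<in> carrier W \<Longrightarrow> len (inv w) = len w"
proof -
  have le: "len (inv w) \<le> len w" if w: "w \<in> carrier W" for w
  proof -
    obtain ws where ws: "ws \<in> lists S" "length ws = len w" "word_prod W ws = w"
      using w by (rule reduced_word)
    then have "rev ws \<in> lists S" by auto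
    from len_le_length[OF this] show ?thesis using ws by (simp add: word_prod_rev)
  qed
  assume "w \<in> carrier W"
  then show ?thesis using le[of w] le[of "inv w"] by simp
qed

text \<open>Parity rules out equal lengths, and subadditivity limits the change to one.\<close>

lemma len_gen_mult_cases:
  assumes "s \<in> S" "w \<in> carrier W"
  obtains (up) "len (s \<otimes> w) = Suc (len w)" | (down) "len w = Suc (len (s \<otimes> w))"
proof -
  obtain ws where ws: "ws \<in> lists S" "length ws = len w" "word_prod W ws = w"
    using assms(2) by (rule reduced_word)
  have "s # ws \<in> lists S" using ws assms by simp
  from even_len_word_prod[OF this] have "even (len (s \<otimes> w)) \<noteq> even (len w)"
    by (simp add: ws(2,3))
  moreover have "len (s \<otimes> w) \<le> Suc (len w)"
    using len_mult_le[of s w] assms by (simp add: len_gen)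
  moreover have "len w \<le> Suc (len (s \<otimes> w))"
    using len_mult_le[of s "s \<otimes> w"] assms by (simp add: len_gen)
  ultimately have "len (s \<otimes> w) = Suc (len w) \<or> len w = Suc (len (s \<otimes> w))"
    by presburger
  then show ?thesis using that(1) that(2) by (elim disjE)
qed

lemma len_mult_gen_cases:
  assumes "s \<in> S" "w \<in> carrier W"
  obtains (up) "len (w \<otimes> s) = Suc (len w)" | (down) "len w = Suc (len (w \<otimes> s))"
proof -
  have "s \<otimes> inv w = inv (w \<otimes> s)" using assms by (simp add: inv_mult_group)
  then have eq: "len (s \<otimes> inv w) = len (w \<otimes> s)" using len_inv[of "w \<otimes> s"] assms by simp
  have inv_w: "inv w \<in> carrier W" using assms by simp
  from assms(1) inv_w show ?thesis
  proof (cases rule: len_gen_mult_cases)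
    case up
    then show ?thesis using eq len_inv[OF assms(2)] that(1) by simp
  next
    case down
    then show ?thesis using eq len_inv[OF assms(2)] that(2) by simp
  qed
qed

text \<open>Let \<open>us\<close> be a reduced word for \<open>s w\<close>. If \<open>s\<close> had
  odd count in \<open>us\<close>, deleting a letter of \<open>us\<close> would give a word for
  \<open>w\<close> that is too short. Hence \<open>s\<close> has odd count in \<open>s # us\<close>,
  and so in every word \<open>ws\<close> for \<open>w\<close>, reduced or not.\<close>

lemma exchange:
  assumes ws: "ws \<in> lists S" and s: "s \<in> S" and less: "len (s \<otimes> word_prod W ws) < len (word_prod W ws)"
  shows "\<exists>i < length ws. s \<otimes> word_prod W ws = word_prod W (delete_nth i ws)"
proof -
  obtain us where us: "us \<in> lists S" "length us = len (s \<otimes> word_prod W ws)"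
    "word_prod W us = s \<otimes> word_prod W ws"
    by (rule reduced_word[of "s \<otimes> word_prod W ws"]) (use ws s in auto)
  have eq: "word_prod W (s # us) = word_prod W ws" using us s ws by simp
  have "\<not> odd_inversion W us s"
  proof
    assume "odd_inversion W us s"
    from odd_inversion_delete[OF us(1) _ this] s obtain i where
      i: "i < length us" "s \<otimes> word_prod W us = word_prod W (delete_nth i us)" by auto
    have "len (word_prod W ws) \<le> length (delete_nth i us)"
      using i len_le_length[OF delete_nth_in_lists[OF us(1)], of i] eq by simp
    then show False using length_delete_nth[OF i(1)] us(2) less by simp
  qed
  then have "odd_inversion W (s # us) s" using s by simp
  moreover have "coxeter_cong W S (s # us) ws" using presentation eq us ws s by simp
  ultimately have "odd_inversion W ws s" using coxeter_cong_invariants gen_closed[OF s] by metis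
  then show ?thesis using odd_inversion_delete ws s by simp
qed

text \<open>Distinguishes which factor loses the letter; in the first case the untouched factor
  \<open>vs\<close> cancels.\<close>

lemma exchange_append:
  assumes "us \<in> lists S" "vs \<in> lists S" "s \<in> S"
    and "len (s \<otimes> word_prod W us \<otimes> word_prod W vs) < len (word_prod W us \<otimes> word_prod W vs)"
  obtains (left) i where "i < length us"
      "s \<otimes> word_prod W us = word_prod W (delete_nth i us)"
    | (right) i where "i < length vs"
      "s \<otimes> word_prod W us \<otimes> word_prod W vs = word_prod W us \<otimes> word_prod W (delete_nth i vs)"
proof -
  have "us @ vs \<in> lists S" using assms by auto
  from exchange[OF this assms(3)] assms obtain i where i: "i < length (us @ vs)"
    "s \<otimes> word_prod W us \<otimes> word_prod W vs = word_prod W (delete_nth i (us @ vs))"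
    by (auto simp: m_assoc)
  note d = delete_nth_in_lists[OF assms(1)] delete_nth_in_lists[OF assms(2)]
  show ?thesis
  proof (cases "i < length us")
    case True
    then have "delete_nth i (us @ vs) = delete_nth i us @ vs" by (simp add: delete_nth_def)
    then have "s \<otimes> word_prod W us \<otimes> word_prod W vs = word_prod W (delete_nth i us) \<otimes> word_prod W vs"
      using i d assms by simp
    then show ?thesis using True left d assms by simp
  next
    case False
    then have "delete_nth i (us @ vs) = us @ delete_nth (i - length us) vs"
      by (simp add: delete_nth_def Suc_diff_le)
    then show ?thesis using i d assms False right[of "i - length us"] by auto
  qed
qed

section \<open>Parabolic subgroups\<close>

lemma parabolic_closed: "K \<subseteq> S \<Longrightarrow> x \<in> generate W K \<Longrightarrow> x \<in> carrier W"
  using generate_incl gens_carrier by blast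

lemma parabolic_mult: "x \<in> generate W K \<Longrightarrow> y \<in> generate W K \<Longrightarrow> x \<otimes> y \<in> generate W K"
  by (rule generate.eng)

lemma parabolic_inv: "K \<subseteq> S \<Longrightarrow> x \<in> generate W K \<Longrightarrow> inv x \<in> generate W K"
  using generate_m_inv_closed gens_carrier by blast

lemma parabolic_word: "K \<subseteq> S \<Longrightarrow> ws \<in> lists K \<Longrightarrow> word_prod W ws \<in> generate W K"
  by (simp add: generate_eq_word_prods)

lemma parabolicE:
  assumes "K \<subseteq> S" "x \<in> generate W K"
  obtains ws where "ws \<in> lists K" "word_prod W ws = x"
proof -
  have "x \<in> word_prod W ` lists K" using assms generate_eq_word_prods by simp
  then show ?thesis using that by blast
qed

text \<open>Induction along any word over \<open>K\<close>: a new letter either lengthens the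
  reduced word found so far or, by exchange, deletes one of its letters. Both operations stay inside
  \<open>K\<close>.\<close>

lemma parabolic_reduced_word:
  assumes "K \<subseteq> S" "x \<in> generate W K"
  obtains ws where "ws \<in> lists K" "length ws = len x" "word_prod W ws = x"
proof -
  have sub: "lists K \<subseteq> lists S" using assms(1) by (rule lists_mono)
  obtain us where "us \<in> lists K" "word_prod W us = x"
    using assms by (rule parabolicE)
  then have "\<exists>ws \<in> lists K. length ws = len x \<and> word_prod W ws = x"
  proof (induction us arbitrary: x rule: list.induct)
    case (Cons s us)
    then obtain vs where vs: "vs \<in> lists K" "length vs = len (word_prod W us)"
      "word_prod W vs = word_prod W us" by auto
    have s: "s \<in> K" "s \<in> S" using Cons.prems assms(1) by auto
    have us: "us \<in> lists K" using Cons.prems by simp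
    have c: "word_prod W us \<in> carrier W" "vs \<in> lists S"
      using word_prod_closed[OF subsetD[OF sub us]] subsetD[OF sub vs(1)] .
    from s(2) c(1) show ?case
    proof (cases rule: len_gen_mult_cases)
      case up
      then show ?thesis using vs s Cons.prems by (intro bexI[of _ "s # vs"]) auto
    next
      case down
      then obtain i where i: "i < length vs" "s \<otimes> word_prod W vs = word_prod W (delete_nth i vs)"
        using exchange[of vs s] vs c s by auto
      then show ?thesis using down Cons.prems vs length_delete_nth[OF i(1)]
        by (intro bexI[of _ "delete_nth i vs"]) (auto simp: delete_nth_in_lists)
    qed
  qed auto
  then show ?thesis using that by blast
qed

lemma gen_in_parabolic:
  assumes "K \<subseteq> S" "s \<in> S" "s \<in> generate W K"
  shows "s \<in> K"
proof -
  obtain ws where ws: "ws \<in> lists K" "length ws = len s" "word_prod W ws = s"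
    using assms(1,3) by (rule parabolic_reduced_word)
  then obtain k where "ws = [k]" using len_gen[OF assms(2)] by (auto simp: length_Suc_conv)
  then show ?thesis using ws assms(1) by auto
qed

text \<open>If \<open>t\<close> shortened \<open>n\<close>, exchange in a word over \<open>L\<close>
  would put \<open>t n\<close>, and hence \<open>t\<close> itself, into \<open>W_L\<close>.\<close>

lemma not_descent_parabolic:
  assumes "L \<subseteq> S" "t \<in> S - L" "n \<in> generate W L"
  shows "len (t \<otimes> n) = Suc (len n)"
proof -
  obtain ws where ws: "ws \<in> lists L" "word_prod W ws = n"
    using assms(1,3) by (rule parabolicE)
  have n: "n \<in> carrier W" "ws \<in> lists S" using assms ws parabolic_closed[OF assms(1)] by auto
  have t: "t \<in> S" using assms by simp
  from t n(1) show ?thesis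
  proof (cases rule: len_gen_mult_cases)
    case down
    then obtain i where "t \<otimes> n = word_prod W (delete_nth i ws)"
      using exchange[of ws t] ws n assms by auto
    then have "t \<otimes> n \<in> generate W L"
      using parabolic_word[OF assms(1) delete_nth_in_lists[OF ws(1)]] by simp
    then have "t \<otimes> n \<otimes> inv n \<in> generate W L"
      using parabolic_mult parabolic_inv[OF assms(1)] assms by simp
    then have "t \<in> generate W L" using n t by (simp add: m_assoc)
    then show ?thesis using gen_in_parabolic[OF assms(1)] t assms(2) by simp
  qed
qed

text \<open>Here \<open>t\<close> is a left descent of \<open>n' t\<close>. Exchange cannot delete a
  letter of \<open>n'\<close>, as this would put \<open>t\<close> into \<open>W_L\<close>; so it
  deletes the final \<open>t\<close>, and \<open>t n' t = n'\<close>.\<close>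

lemma parabolic_intertwine:
  assumes "L \<subseteq> S" "t \<in> S - L" "n \<in> generate W L" "n' \<in> generate W L" "t \<otimes> n = n' \<otimes> t"
  shows "n = n'"
proof -
  have t: "t \<in> S" using assms by simp
  have c: "n \<in> carrier W" "n' \<in> carrier W" using assms parabolic_closed[OF assms(1)] by auto
  obtain ws where ws: "ws \<in> lists L" "word_prod W ws = n'"
    using assms(1,4) by (rule parabolicE)
  have ws': "ws \<in> lists S" "[t] \<in> lists S" using ws(1) assms(1) t by auto
  have "len (t \<otimes> (t \<otimes> n)) < len (t \<otimes> n)"
    using not_descent_parabolic[OF assms(1-3)] t c by simp
  then have "len (t \<otimes> word_prod W ws \<otimes> word_prod W [t]) < len (word_prod W ws \<otimes> word_prod W [t])"
    using assms(5) ws t c by (simp add: m_assoc)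
  from ws' t this show ?thesis
  proof (cases rule: exchange_append)
    case (left i)
    then have "t \<otimes> n' \<in> generate W L"
      using parabolic_word[OF assms(1) delete_nth_in_lists[OF ws(1)]] ws by simp
    then have "t \<otimes> n' \<otimes> inv n' \<in> generate W L"
      using parabolic_mult parabolic_inv[OF assms(1)] assms by simp
    then have "t \<in> generate W L" using c t by (simp add: m_assoc)
    then show ?thesis using gen_in_parabolic[OF assms(1)] t assms(2) by simp
  next
    case (right i)
    then have "t \<otimes> (n' \<otimes> t) = n'" using ws t c by (simp add: delete_nth_def m_assoc)
    then show ?thesis using assms(5) t c by (metis gen_mult_cancel)
  qed
qed

text \<open>The first letter \<open>b\<close> of \<open>n = b m\<close> is a left descent of
  \<open>t n\<close>. Exchange then gives \<open>b t = t x\<close> with \<open>x\<close> in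
  \<open>W_L\<close>, and \<open>parabolic_intertwine\<close> yields \<open>x = b\<close>.
  Cancelling \<open>b\<close> shows that \<open>t\<close> commutes with \<open>m\<close>
  too.\<close>

lemma parabolic_commute_letters:
  assumes "L \<subseteq> S" "t \<in> S - L"
  shows "ws \<in> lists L \<Longrightarrow> length ws = len (word_prod W ws) \<Longrightarrow>
    t \<otimes> word_prod W ws = word_prod W ws \<otimes> t \<Longrightarrow> a \<in> set ws \<Longrightarrow> t \<otimes> a = a \<otimes> t"
proof (induction ws)
  case (Cons b ws)
  have t: "t \<in> S" "t \<in> carrier W" and b: "b \<in> L" "b \<in> S" "b \<in> carrier W" and ws: "ws \<in> lists L" "ws \<in> lists S"
    using assms Cons.prems by auto
  let ?m = "word_prod W ws"
  let ?n = "b \<otimes> ?m"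
  have n: "?n \<in> generate W L" "?m \<in> generate W L" "?n \<in> carrier W" "?m \<in> carrier W"
    using parabolic_word[OF assms(1), of "b # ws"] parabolic_word[OF assms(1), of ws] b ws by auto
  have comm: "t \<otimes> ?n = ?n \<otimes> t" using Cons.prems by simp
  have len_n: "len ?n = Suc (length ws)" using Cons.prems by simp
  have red: "length ws = len ?m"
    using len_le_length[OF ws(2)] len_mult_le[of b ?m] b n len_n len_gen[of b] by simp
  \<comment> \<open>Since \<open>t\<close> commutes with \<open>n\<close>, the product
    \<open>b t n\<close> equals \<open>m t\<close>, which is shorter than
    \<open>t n\<close>.\<close>
  have "len (b \<otimes> (t \<otimes> ?n)) = len (?m \<otimes> t)" using comm b t n by (simp add: m_assoc)
  also have "\<dots> \<le> Suc (length ws)" using len_mult_le[of ?m t] n t red len_gen[of t] by simp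
  also have "\<dots> < len (t \<otimes> ?n)" using not_descent_parabolic[OF assms n(1)] len_n by simp
  finally have less: "len (b \<otimes> word_prod W [t] \<otimes> word_prod W (b # ws)) < len (word_prod W [t] \<otimes> word_prod W (b # ws))"
    using b t n by (simp add: m_assoc)
  have lists: "[t] \<in> lists S" "b # ws \<in> lists S" "b # ws \<in> lists L" using b t ws by auto
  have tb: "t \<otimes> b = b \<otimes> t"
    using lists(1,2) b(2) less
  proof (cases rule: exchange_append)
    case (left i)
    then have "b \<otimes> t = \<one>" using t by (simp add: delete_nth_def)
    then have "b = t" using b t by (metis gen_mult_cancel r_one)
    then show ?thesis by simp
  next
    case (right i)
    let ?n' = "word_prod W (delete_nth i (b # ws))"
    have n': "?n' \<in> generate W L" "?n' \<in> carrier W"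
      using parabolic_word[OF assms(1) delete_nth_in_lists[OF lists(3)]] parabolic_closed[OF assms(1)] by auto
    have r: "b \<otimes> t \<otimes> ?n = t \<otimes> ?n'" using right t by simp
    have "t \<otimes> (?n' \<otimes> inv ?n) = b \<otimes> t \<otimes> ?n \<otimes> inv ?n"
      unfolding r using t n n' by (simp add: m_assoc)
    then have "t \<otimes> (?n' \<otimes> inv ?n) = b \<otimes> t"
      using b(3) t(2) n(3) by (metis inv_solve_right' m_closed)
    moreover have "?n' \<otimes> inv ?n \<in> generate W L"
      using n n' parabolic_mult parabolic_inv[OF assms(1)] by simp
    moreover have "b \<in> generate W L" using b by (simp add: generate.incl)
    ultimately have "?n' \<otimes> inv ?n = b"
      using parabolic_intertwine[OF assms] by blast
    then show ?thesis using \<open>t \<otimes> (?n' \<otimes> inv ?n) = b \<otimes> t\<close> by simp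
  qed
  have "b \<otimes> (t \<otimes> ?m) = b \<otimes> (?m \<otimes> t)"
    using comm tb b t n by (metis m_assoc)
  then have "t \<otimes> ?m = ?m \<otimes> t" using b t n by (metis gen_mult_cancel m_closed)
  then show ?case using Cons.IH ws red tb Cons.prems by auto
qed simp

text \<open>Lengths add for the shortest element \<open>y\<close> of the coset \<open>W_K w\<close>.
  An element \<open>w\<close> without left descents in \<open>K\<close> must then be that shortest
  element.\<close>

lemma len_mult_parabolic:
  assumes K: "K \<subseteq> S" and w: "w \<in> carrier W"
    and min: "\<And>t. t \<in> K \<Longrightarrow> len w < len (t \<otimes> w)" and v: "v \<in> generate W K"
  shows "len (v \<otimes> w) = len v + len w"
proof -
  define P where "P = (\<lambda>y. \<exists>v \<in> generate W K. y = v \<otimes> w)"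
  have "P w" unfolding P_def using w by (intro bexI[of _ \<one>]) (auto intro: generate.one)
  from arg_min_nat_lemma[of P, OF this, of len]
  obtain y where y: "P y" "\<And>z. P z \<Longrightarrow> len y \<le> len z" by blast
  obtain v0 where v0: "v0 \<in> generate W K" "y = v0 \<otimes> w" using y(1) P_def by blast
  have yc: "y \<in> carrier W" and v0c: "v0 \<in> carrier W" using v0 w parabolic_closed K by auto
  have P_mult: "P (u \<otimes> y)" if "u \<in> generate W K" for u
    unfolding P_def using that v0 w parabolic_closed[OF K] parabolic_mult
    by (intro bexI[of _ "u \<otimes> v0"]) (auto simp: m_assoc)
  have add: "ts \<in> lists K \<Longrightarrow> length ts = len (word_prod W ts) \<Longrightarrow>
    len (word_prod W ts \<otimes> y) = length ts + len y" for ts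
  proof (induction ts)
    case Nil
    then show ?case using yc by simp
  next
    case (Cons t ts)
    obtain ys where ys: "ys \<in> lists S" "length ys = len y" "word_prod W ys = y"
      using yc by (rule reduced_word)
    have t: "t \<in> K" "t \<in> S" "t \<in> carrier W" and ts: "ts \<in> lists K" "ts \<in> lists S"
      using Cons.prems K by auto
    let ?m = "word_prod W ts"
    have m: "?m \<in> carrier W" "?m \<in> generate W K" using ts parabolic_word[OF K] by auto
    have red: "length ts = len ?m"
      using len_le_length[OF ts(2)] len_mult_le[of t ?m] t m Cons.prems len_gen[of t] by simp
    have IH: "len (?m \<otimes> y) = length ts + len y" using Cons.IH ts red by simp
    have "?m \<otimes> y \<in> carrier W" using m yc by simp
    with t(2) show ?case
    proof (cases rule: len_gen_mult_cases)
      case up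
      then show ?thesis using IH t m yc by (simp add: m_assoc)
    next
      case down
      then have "len (t \<otimes> word_prod W ts \<otimes> word_prod W ys) < len (word_prod W ts \<otimes> word_prod W ys)"
        using ys t m yc by (simp add: m_assoc)
      with ts(2) ys(1) t(2) show ?thesis
      proof (cases rule: exchange_append)
        case (left i)
        then have "len (word_prod W (t # ts)) < length ts"
          using len_le_length[OF delete_nth_in_lists[OF ts(2)], of i] length_delete_nth[OF left(1)] by simp
        then show ?thesis using Cons.prems by simp
      next
        case (right i)
        let ?y = "word_prod W (delete_nth i ys)"
        have yd: "?y \<in> carrier W" "len ?y < len y"
          using delete_nth_in_lists[OF ys(1)] len_le_length[OF delete_nth_in_lists[OF ys(1)], of i]
            length_delete_nth[OF right(1)] ys(2) by auto
        have r: "t \<otimes> ?m \<otimes> y = ?m \<otimes> ?y" using right ys by simp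
        then have "?y = inv ?m \<otimes> (t \<otimes> ?m \<otimes> y)"
          using m yd by (simp flip: m_assoc)
        then have "?y = (inv ?m \<otimes> (t \<otimes> ?m)) \<otimes> y"
          using m t yc by (simp add: m_assoc)
        moreover have "inv ?m \<otimes> (t \<otimes> ?m) \<in> generate W K"
          using m t parabolic_mult parabolic_inv[OF K] by (meson generate.incl)
        ultimately have "P ?y" using P_mult by metis
        then show ?thesis using y(2) yd by fastforce
      qed
    qed
  qed
  have add': "len (u \<otimes> y) = len u + len y" if u: "u \<in> generate W K" for u
    using add parabolic_reduced_word[OF K u] by metis
  have w_eq: "w = inv v0 \<otimes> y" using v0 v0c w by (simp flip: m_assoc)
  \<comment> \<open>Otherwise the first letter of a reduced word for the inverse of
    \<open>v0\<close> is a left descent of \<open>w\<close> lying in \<open>K\<close>.\<close>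
  have "v0 = \<one>"
  proof (rule ccontr)
    assume "v0 \<noteq> \<one>"
    obtain ts where ts: "ts \<in> lists K" "length ts = len (inv v0)" "word_prod W ts = inv v0"
      using parabolic_reduced_word[OF K parabolic_inv[OF K v0(1)]] .
    with \<open>v0 \<noteq> \<one>\<close> v0c have "ts \<noteq> []" by (metis inv_eq_1_iff word_prod_Nil)
    then obtain t us where us: "ts = t # us" by (cases ts) auto
    have t: "t \<in> K" "t \<in> S" and us': "us \<in> lists K" "us \<in> lists S" using ts us K by auto
    have "t \<otimes> w = word_prod W us \<otimes> y"
      using w_eq ts(3) us t us' yc by (simp flip: ts(3) add: m_assoc)
    then have "len (t \<otimes> w) = len (word_prod W us) + len y"
      using add' us' parabolic_word[OF K] by simp
    also have "\<dots> < len (inv v0) + len y"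
      using len_le_length[OF us'(2)] us ts by simp
    also have "\<dots> = len w" using add'[OF parabolic_inv[OF K v0(1)]] w_eq by simp
    finally show False using min[OF t(1)] by simp
  qed
  then show ?thesis using v0 add'[OF v] w by simp
qed

section \<open>Elements intertwining their non-descents\<close>

text \<open>The order of \<open>a b\<close> divides 2, so it is neither 0, the code for infinity,
  nor at least 3.\<close>

lemma no_diagram_edge_if_commute:
  assumes "a \<in> S" "b \<in> S" "a \<otimes> b = b \<otimes> a"
  shows "(a, b) \<notin> diagram_edges"
proof -
  have "a \<otimes> b \<otimes> (a \<otimes> b) = a \<otimes> b \<otimes> (b \<otimes> a)" by (simp only: assms(3))
  also have "\<dots> = \<one>" using assms(1,2) by (simp add: m_assoc)
  finally have "(a \<otimes> b) [^] (2::nat) = \<one>" using assms(1,2) by (simp add: numeral_2_eq_2)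
  then have "coxeter_m W a b dvd 2"
    using pow_eq_id[of "a \<otimes> b" 2] assms(1,2) by (simp add: coxeter_m_def)
  then have "coxeter_m W a b \<noteq> 0" "coxeter_m W a b \<le> 2" using dvd_imp_le[of _ "2::nat"] by (auto intro: Nat.gr0I)
  then show ?thesis by (simp add: diagram_edges_def)
qed

text \<open>Reduced words over \<open>M\<close> extend to reduced words of \<open>x\<close>: when
  \<open>s\<close> is put in front, exchange cannot delete from \<open>us\<close>, because
  \<open>s # us\<close> is reduced, and so it shortens the remainder \<open>ys\<close>.\<close>

lemma word_prefix_if_descents:
  assumes "M \<subseteq> S" "x \<in> carrier W" and desc: "\<And>s. s \<in> M \<Longrightarrow> len (s \<otimes> x) < len x"
  shows "us \<in> lists M \<Longrightarrow> length us = len (word_prod W us) \<Longrightarrow>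
    \<exists>ys \<in> lists S. length us + length ys = len x \<and> word_prod W us \<otimes> word_prod W ys = x"
proof (induction us)
  case Nil
  obtain ys where "ys \<in> lists S" "length ys = len x" "word_prod W ys = x"
    using assms(2) by (rule reduced_word)
  then show ?case using assms(2) by auto
next
  case (Cons s us)
  have s: "s \<in> M" "s \<in> S" "s \<in> carrier W" and us: "us \<in> lists M" "us \<in> lists S"
    using Cons.prems assms(1) by auto
  let ?m = "word_prod W us"
  have m: "?m \<in> carrier W" using us by simp
  have red: "length us = len ?m"
    using len_le_length[OF us(2)] len_mult_le[of s ?m] s m Cons.prems len_gen[of s] by simp
  from Cons.IH[OF us(1) red] obtain ys where ys: "ys \<in> lists S" "length us + length ys = len x"
    "?m \<otimes> word_prod W ys = x" by blast
  have yc: "word_prod W ys \<in> carrier W" using ys by simp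
  have "len (s \<otimes> ?m \<otimes> word_prod W ys) < len (?m \<otimes> word_prod W ys)"
    using desc[OF s(1)] s m yc by (simp add: m_assoc ys(3))
  with us(2) ys(1) s(2) show ?case
  proof (cases rule: exchange_append)
    case (left i)
    then have "len (word_prod W (s # us)) < length us"
      using len_le_length[OF delete_nth_in_lists[OF us(2)], of i] length_delete_nth[OF left(1)] by simp
    then show ?thesis using Cons.prems by simp
  next
    case (right i)
    let ?zs = "delete_nth i ys"
    have zs: "?zs \<in> lists S" "word_prod W ?zs \<in> carrier W" "Suc (length ?zs) = length ys"
      using delete_nth_in_lists[OF ys(1)] length_delete_nth[OF right(1)] by auto
    have "s \<otimes> x = ?m \<otimes> word_prod W ?zs" using right(2) s m yc by (simp add: m_assoc ys(3))
    then have "x = s \<otimes> (?m \<otimes> word_prod W ?zs)" using s assms(2) by (metis gen_mult_cancel)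
    then have "word_prod W (s # us) \<otimes> word_prod W ?zs = x" using s m zs by (simp add: m_assoc)
    then show ?thesis using zs ys(2) by (intro bexI[of _ ?zs]) auto
  qed
qed

text \<open>Exchange attaches to each \<open>s\<close> in \<open>M\<close> a position in a reduced
  word of \<open>x\<close> that determines \<open>s\<close>, so \<open>M\<close> is finite even if
  \<open>S\<close> is not. By the prefix property lengths in \<open>W_M\<close> are at most
  \<open>len x\<close>, which leaves finitely many words.\<close>

lemma finite_parabolic_if_descents:
  assumes "M \<subseteq> S" "x \<in> carrier W" and desc: "\<And>s. s \<in> M \<Longrightarrow> len (s \<otimes> x) < len x"
  shows "finite (generate W M)"
proof -
  obtain xs where xs: "xs \<in> lists S" "length xs = len x" "word_prod W xs = x"
    using assms(2) by (rule reduced_word)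
  have "M \<subseteq> (\<lambda>i. word_prod W (delete_nth i xs) \<otimes> inv x) ` {..<length xs}"
  proof
    fix s assume s: "s \<in> M"
    then have sS: "s \<in> S" using assms(1) by blast
    obtain i where i: "i < length xs" "s \<otimes> x = word_prod W (delete_nth i xs)"
      using exchange[OF xs(1) sS] desc[OF s] xs(3) by auto
    have "s = s \<otimes> x \<otimes> inv x" using sS assms(2) by (simp add: m_assoc)
    then show "s \<in> (\<lambda>i. word_prod W (delete_nth i xs) \<otimes> inv x) ` {..<length xs}"
      using i by auto
  qed
  then have "finite M" by (rule finite_subset) simp
  moreover have "generate W M \<subseteq> word_prod W ` {us. set us \<subseteq> M \<and> length us \<le> len x}"
  proof
    fix y assume "y \<in> generate W M"
    with assms(1) obtain us where us: "us \<in> lists M" "length us = len y" "word_prod W us = y"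
      by (rule parabolic_reduced_word)
    have "length us \<le> len x"
      using word_prefix_if_descents[OF assms us(1)] us by auto
    then show "y \<in> word_prod W ` {us. set us \<subseteq> M \<and> length us \<le> len x}" using us by auto
  qed
  ultimately show ?thesis by (metis finite_lists_length_le finite_imageI finite_subset)
qed

text \<open>The group-theoretic half of the argument. In the application \<open>w\<close> is the
  Weyl distance from a chamber of maximal displacement to its image, and \<open>t\<close> is
  \<open>\<sigma> s\<close>.\<close>

lemma not_purely_infinite_if_descent_or_intertwine:
  assumes w: "w \<in> carrier W" "w \<noteq> \<one>"
    and dich: "\<And>s. s \<in> S \<Longrightarrow> len (s \<otimes> w) < len w \<or>
      (len w < len (s \<otimes> w) \<and> (\<exists>t \<in> S. s \<otimes> w = w \<otimes> t))"
  shows "\<not> purely_infinite"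
proof -
  define J where "J = {s \<in> S. len (s \<otimes> w) < len w}"
  define K where "K = S - J"
  have JS: "J \<subseteq> S" and KS: "K \<subseteq> S" by (auto simp: J_def K_def)
  obtain ws where ws: "ws \<in> lists S" "length ws = len w" "word_prod W ws = w"
    using w(1) by (rule reduced_word)
  have "J \<noteq> {}"
  proof -
    obtain a us where "ws = a # us" using ws(3) w(2) by (cases ws) auto
    then have a: "a \<in> S" "us \<in> lists S" "w = a \<otimes> word_prod W us" "len w = Suc (length us)"
      using ws by auto
    then have "len (a \<otimes> w) < len w" using len_le_length[OF a(2)] by simp
    then show ?thesis using a J_def by blast
  qed

  \<comment> \<open>Letters of \<open>K\<close> are ascents, so each passes through \<open>w\<close>
    and emerges on the right as a generator; the word keeps its length.\<close>
  have push: "ts \<in> lists K \<Longrightarrow> \<exists>us \<in> lists S. length us = length ts \<and> word_prod W ts \<otimes> w = w \<otimes> word_prod W us" for ts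
  proof (induction ts)
    case Nil
    then show ?case using w by auto
  next
    case (Cons t ts)
    then obtain us where us: "us \<in> lists S" "length us = length ts"
      "word_prod W ts \<otimes> w = w \<otimes> word_prod W us" by auto
    have t: "t \<in> K" "t \<in> S" "ts \<in> lists S" using Cons.prems KS by auto
    then obtain u where u: "u \<in> S" "t \<otimes> w = w \<otimes> u" using dich[of t] K_def J_def by auto
    have "word_prod W (t # ts) \<otimes> w = t \<otimes> w \<otimes> word_prod W us"
      using t us w by (simp add: m_assoc)
    also have "\<dots> = w \<otimes> word_prod W (u # us)" using u us w by (simp add: m_assoc)
    finally show ?case using u us by (intro bexI[of _ "u # us"]) auto
  qed
  have add: "len (v \<otimes> w) = len v + len w" if v: "v \<in> generate W K" for v
  proof (rule len_mult_parabolic[OF KS w(1) _ v])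
    fix t assume "t \<in> K"
    then show "len w < len (t \<otimes> w)" using dich[of t] K_def J_def by auto
  qed
  \<comment> \<open>Pushing \<open>v\<close> through \<open>w\<close> lets \<open>s\<close> act on
    \<open>w\<close> directly: \<open>s v w = (s w) v'\<close>, where \<open>v'\<close> is a product
    of \<open>len v\<close> generators.\<close>
  have J_descent: "len (s \<otimes> v \<otimes> w) < len (v \<otimes> w)" if s: "s \<in> J" and v: "v \<in> generate W K" for s v
  proof -
    obtain ts where ts: "ts \<in> lists K" "length ts = len v" "word_prod W ts = v"
      using KS v by (rule parabolic_reduced_word)
    then obtain us where us: "us \<in> lists S" "length us = len v" "v \<otimes> w = w \<otimes> word_prod W us"
      using push by metis
    have c: "s \<in> carrier W" "v \<in> carrier W" "word_prod W us \<in> carrier W"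
      using s v JS us parabolic_closed[OF KS] by auto
    have "s \<otimes> v \<otimes> w = s \<otimes> w \<otimes> word_prod W us" using c w us by (simp add: m_assoc)
    then have "len (s \<otimes> v \<otimes> w) \<le> len (s \<otimes> w) + len v"
      using len_mult_le[of "s \<otimes> w" "word_prod W us"] len_le_length[OF us(1)] us(2) c w by simp
    also have "\<dots> < len w + len v" using s by (simp add: J_def)
    finally show ?thesis using add[OF v] by simp
  qed

  define R where "R = {inv v \<otimes> s \<otimes> v | s v. s \<in> J \<and> v \<in> generate W K}"
  have RI: "inv v \<otimes> s \<otimes> v \<in> R" if "s \<in> J" "v \<in> generate W K" for s v
    using that R_def by blast
  have R_carrier: "r \<in> carrier W" if "r \<in> R" for r
    using that JS parabolic_closed[OF KS] by (auto simp: R_def)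
  \<comment> \<open>Exchange in \<open>v w\<close> cannot delete from \<open>v\<close>, since
    \<open>s\<close> is not in \<open>W_K\<close>. So it deletes letter \<open>i\<close> of
    \<open>ws\<close>, and \<open>i\<close> alone determines the reflection.\<close>
  have "R \<subseteq> (\<lambda>i. word_prod W (delete_nth i ws) \<otimes> inv w) ` {..<length ws}"
  proof
    fix r assume "r \<in> R"
    then obtain s v where sv: "s \<in> J" "v \<in> generate W K" "r = inv v \<otimes> s \<otimes> v"
      unfolding R_def by blast
    obtain vs where vs: "vs \<in> lists K" "word_prod W vs = v" using KS sv(2) by (rule parabolicE)
    have s: "s \<in> S" "s \<notin> K" "s \<in> carrier W" and vs': "vs \<in> lists S" and v: "v \<in> carrier W"
      using sv JS vs KS parabolic_closed[OF KS] by (auto simp: K_def)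
    have "len (s \<otimes> word_prod W vs \<otimes> word_prod W ws) < len (word_prod W vs \<otimes> word_prod W ws)"
      using J_descent[OF sv(1,2)] vs ws by simp
    with vs' ws(1) s(1) show "r \<in> (\<lambda>i. word_prod W (delete_nth i ws) \<otimes> inv w) ` {..<length ws}"
    proof (cases rule: exchange_append)
      case (left i)
      then have "s \<otimes> v \<in> generate W K"
        using parabolic_word[OF KS delete_nth_in_lists[OF vs(1)]] vs by simp
      then have "s \<otimes> v \<otimes> inv v \<in> generate W K"
        using parabolic_mult parabolic_inv[OF KS] sv by simp
      then have "s \<in> generate W K" using s v by (simp add: m_assoc)
      then show ?thesis using gen_in_parabolic[OF KS] s by blast
    next
      case (right i)
      let ?y = "word_prod W (delete_nth i ws)"
      have y: "?y \<in> carrier W" using delete_nth_in_lists[OF ws(1)] by simp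
      have eq: "s \<otimes> v \<otimes> w = v \<otimes> ?y" using right vs ws by simp
      have "r = inv v \<otimes> (s \<otimes> v \<otimes> w) \<otimes> inv w"
        using sv s v w by (simp add: m_assoc)
      also have "\<dots> = ?y \<otimes> inv w" unfolding eq using v y w by (simp flip: m_assoc)
      finally show ?thesis using right(1) by auto
    qed
  qed
  then have finR: "finite R" by (rule finite_subset) simp

  define N where "N = {n \<in> generate W K. \<forall>r \<in> R. n \<otimes> r = r \<otimes> n}"
  \<comment> \<open>The words are required to be reduced because
    \<open>parabolic_commute_letters\<close> applies to reduced words.\<close>
  define L where "L = {a. \<exists>ts \<in> lists K. length ts = len (word_prod W ts) \<and> word_prod W ts \<in> N \<and> a \<in> set ts}"
  have LK: "L \<subseteq> K" by (auto simp: L_def)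
  have LS: "L \<subseteq> S" using LK KS by blast
  have NL: "n \<in> generate W L" if n: "n \<in> N" for n
  proof -
    have "n \<in> generate W K" using n N_def by blast
    with KS obtain ts where ts: "ts \<in> lists K" "length ts = len n" "word_prod W ts = n"
      by (rule parabolic_reduced_word)
    then have "ts \<in> lists L" using n by (auto simp: L_def)
    then show ?thesis using parabolic_word[OF LS] ts by blast
  qed
  have commute_letters: "t \<otimes> a = a \<otimes> t"
    if t: "t \<in> S - L" and a: "a \<in> L" and comm: "\<And>n. n \<in> N \<Longrightarrow> t \<otimes> n = n \<otimes> t" for t a
  proof -
    obtain ts where ts: "ts \<in> lists K" "length ts = len (word_prod W ts)" "word_prod W ts \<in> N" "a \<in> set ts"
      using a L_def by blast
    then have "ts \<in> lists L" by (auto simp: L_def)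
    from parabolic_commute_letters[OF LS t this ts(2) comm[OF ts(3)] ts(4)] show ?thesis .
  qed
  have conj_R: "inv u \<otimes> r \<otimes> u \<in> R" if u: "u \<in> generate W K" and r: "r \<in> R" for u r
  proof -
    obtain s v where sv: "s \<in> J" "v \<in> generate W K" "r = inv v \<otimes> s \<otimes> v"
      using r R_def by blast
    have c: "u \<in> carrier W" "v \<in> carrier W" "s \<in> carrier W"
      using u sv JS parabolic_closed[OF KS] by auto
    have "inv u \<otimes> r \<otimes> u = inv (v \<otimes> u) \<otimes> s \<otimes> (v \<otimes> u)"
      using c sv(3) by (simp add: m_assoc inv_mult_group)
    then show ?thesis using RI[OF sv(1) parabolic_mult[OF sv(2) u]] by simp
  qed
  \<comment> \<open>An element of \<open>J\<close> lies in \<open>R\<close>, so \<open>N\<close>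
    centralizes it by definition. For \<open>t\<close> in \<open>K - L\<close> the conjugate
    \<open>t n t\<close> is again in \<open>N\<close>, hence in \<open>W_L\<close>, and
    \<open>parabolic_intertwine\<close> identifies it with \<open>n\<close>.\<close>
  have comm: "t \<otimes> a = a \<otimes> t" if t: "t \<in> S - L" and a: "a \<in> L" for t a
  proof (rule commute_letters[OF t a])
    fix n assume n: "n \<in> N"
    have nK: "n \<in> generate W K" and nc: "n \<in> carrier W" using n N_def parabolic_closed[OF KS] by auto
    have tS: "t \<in> S" "t \<in> carrier W" using t by auto
    show "t \<otimes> n = n \<otimes> t"
    proof (cases "t \<in> J")
      case True
      then have "inv \<one> \<otimes> t \<otimes> \<one> \<in> R" using RI generate.one by blast
      then show ?thesis using n tS by (simp add: N_def)
    next
      case False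
      then have tK: "t \<in> generate W K" using tS K_def generate.incl[of t K W] by blast
      let ?n = "t \<otimes> n \<otimes> t"
      have "?n \<otimes> r = r \<otimes> ?n" if r: "r \<in> R" for r
      proof -
        have rc: "r \<in> carrier W" using R_carrier r by blast
        have "t \<otimes> r \<otimes> t \<in> R" using conj_R[OF tK r] tS by simp
        then have "n \<otimes> (t \<otimes> r \<otimes> t) = t \<otimes> r \<otimes> t \<otimes> n" using n N_def by blast
        then have "t \<otimes> (n \<otimes> (t \<otimes> r \<otimes> t)) \<otimes> t = t \<otimes> (t \<otimes> r \<otimes> t \<otimes> n) \<otimes> t" by simp
        then show ?thesis using tS nc rc by (simp add: m_assoc)
      qed
      then have "?n \<in> N" using N_def tK nK parabolic_mult by blast
      then have "n = ?n"
        using parabolic_intertwine[OF LS t NL NL, of n ?n] n tS nc by (simp add: m_assoc)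
      then have "t \<otimes> n = t \<otimes> (t \<otimes> n \<otimes> t)" by simp
      then show ?thesis using tS nc by (simp add: m_assoc)
    qed
  qed

  let ?P = "generate W (K - L)"
  have KLS: "K - L \<subseteq> S" using KS by blast
  have PK: "?P \<subseteq> generate W K" by (rule mono_generate) blast
  have finP: "finite ?P"
  proof -
    \<comment> \<open>Restricting to \<open>R\<close> turns the conjugations into elements of a
      finite set of extensional functions.\<close>
    let ?act = "\<lambda>u. restrict (\<lambda>r. inv u \<otimes> r \<otimes> u) R"
    have "?act ` ?P \<subseteq> R \<rightarrow>\<^sub>E R" using conj_R PK by auto
    then have "finite (?act ` ?P)" using finite_PiE[OF finR, of "\<lambda>_. R"] finR finite_subset by blast
    moreover have "inj_on ?act ?P"
    proof (rule inj_onI)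
      fix u u' assume u: "u \<in> ?P" "u' \<in> ?P" and eq: "?act u = ?act u'"
      have c: "u \<in> carrier W" "u' \<in> carrier W" using u parabolic_closed[OF KLS] by auto
      let ?n = "u' \<otimes> inv u"
      have nP: "?n \<in> ?P" using u parabolic_mult parabolic_inv[OF KLS] by simp
      have "?n \<otimes> r = r \<otimes> ?n" if r: "r \<in> R" for r
      proof -
        have rc: "r \<in> carrier W" using R_carrier r by blast
        have "inv u \<otimes> r \<otimes> u = inv u' \<otimes> r \<otimes> u'" using fun_cong[OF eq, of r] r by simp
        then have "u' \<otimes> (inv u \<otimes> r \<otimes> u) \<otimes> inv u = u' \<otimes> (inv u' \<otimes> r \<otimes> u') \<otimes> inv u" by simp
        moreover have "u' \<otimes> (inv u \<otimes> r \<otimes> u) \<otimes> inv u = ?n \<otimes> r" using c rc by (simp add: m_assoc)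
        moreover have "u' \<otimes> (inv u' \<otimes> r \<otimes> u') \<otimes> inv u = r \<otimes> ?n" using c rc by (simp flip: m_assoc)
        ultimately show ?thesis by simp
      qed
      then have nN: "?n \<in> N" using nP PK N_def by blast
      obtain ts where ts: "ts \<in> lists (K - L)" "length ts = len ?n" "word_prod W ts = ?n"
        using KLS nP by (rule parabolic_reduced_word)
      \<comment> \<open>This element of \<open>N\<close> has a reduced word over
        \<open>K - L\<close>, while the definition of \<open>L\<close> puts all letters of that word
        into \<open>L\<close>.\<close>
      have "ts = []"
      proof (rule ccontr)
        assume "ts \<noteq> []"
        then obtain a where "a \<in> set ts" by (cases ts) auto
        moreover have "ts \<in> lists K" using ts by auto
        ultimately have "a \<in> L" unfolding L_def using ts(2,3) nN
          by (intro CollectI bexI[of _ ts]) simp_all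
        then show False using \<open>a \<in> set ts\<close> ts by auto
      qed
      then have "?n = \<one>" using ts by simp
      then show "u = u'" using c by (metis inv_equality inv_inv inv_closed)
    qed
    ultimately show ?thesis by (rule finite_imageD)
  qed
  have "\<one> \<in> ?P" by (rule generate.one)
  then have "Max (len ` ?P) \<in> len ` ?P" using finP by (intro Max_in) auto
  \<comment> \<open>A longest element of the finite group \<open>W_(K-L)\<close>: left
    multiplication by a letter of \<open>K - L\<close> must shorten it, and lengths add in
    \<open>v w\<close>.\<close>
  then obtain v where v: "v \<in> ?P" "len v = Max (len ` ?P)" by auto
  have vmax: "len u \<le> len v" if "u \<in> ?P" for u using that v finP by simp
  have vc: "v \<in> carrier W" "v \<in> generate W K" using v PK parabolic_closed[OF KLS] by auto
  have "finite (generate W (S - L))"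
  proof (rule finite_parabolic_if_descents)
    show "v \<otimes> w \<in> carrier W" using vc w by simp
    fix s assume s: "s \<in> S - L"
    then have sS: "s \<in> S" "s \<in> carrier W" by auto
    have "len (s \<otimes> v \<otimes> w) < len (v \<otimes> w)"
    proof (cases "s \<in> J")
      case True
      then show ?thesis using J_descent vc by blast
    next
      case False
      then have "s \<in> ?P" using s K_def generate.incl[of s "K - L" W] by blast
      then have "len (s \<otimes> v) \<le> len v" using vmax parabolic_mult v(1) by blast
      with sS(1) vc(1) have "len (s \<otimes> v) < len v" by (cases rule: len_gen_mult_cases) auto
      then show ?thesis using len_mult_le[of "s \<otimes> v" w] add[OF vc(2)] sS vc w by simp
    qed
    then show "len (s \<otimes> (v \<otimes> w)) < len (v \<otimes> w)" using sS vc w by (simp add: m_assoc)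
  qed blast
  moreover obtain s where s: "s \<in> J" using \<open>J \<noteq> {}\<close> by blast
  define C where "C = {t. (s, t) \<in> diagram_edges\<^sup>*}"
  \<comment> \<open>A path in the diagram starting in \<open>J\<close> cannot enter
    \<open>L\<close>, because no edge joins commuting generators.\<close>
  have "C \<subseteq> S - L"
  proof
    fix t assume "t \<in> C"
    then have "(s, t) \<in> diagram_edges\<^sup>*" by (simp add: C_def)
    then show "t \<in> S - L"
    proof (induction rule: rtrancl_induct)
      case base
      then show ?case using s LK JS K_def by blast
    next
      case (step a b)
      have "b \<in> S" using step.hyps(2) by (simp add: diagram_edges_def)
      moreover have "b \<notin> L"
        using comm[OF step.IH] no_diagram_edge_if_commute[of a b] step \<open>b \<in> S\<close> by blast
      ultimately show ?case by simp
    qed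
  qed
  then have "generate W C \<subseteq> generate W (S - L)" by (rule mono_generate)
  ultimately have "finite (generate W C)" by (rule rev_finite_subset)
  moreover have "C \<in> diagram_components" using s JS unfolding diagram_components_def C_def by blast
  ultimately show ?thesis unfolding purely_infinite_def by blast
qed

end

section \<open>Buildings\<close>

context building
begin

section \<open>Galleries and symmetry of the Weyl distance\<close>

primrec gallery :: "'w list \<Rightarrow> 'c \<Rightarrow> 'c \<Rightarrow> bool" where
  "gallery [] C D \<longleftrightarrow> C = D"
| "gallery (s # ws) C D \<longleftrightarrow> (\<exists>C' \<in> chambers. \<delta> C' C = s \<and> gallery ws C' D)"

lemma delta_self: "C \<in> chambers \<Longrightarrow> \<delta> C C = \<one>"
  by (simp add: delta_eq_one_iff)

text \<open>Axiom (2) for a step from \<open>D\<close> to \<open>C\<close>, with \<open>C\<close>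
  also as target, leaves \<open>\<one> = s \<otimes> \<delta> D C\<close> as the only possibility,
  since \<open>C\<close> and \<open>D\<close> differ.\<close>

lemma delta_gen_sym:
  assumes "C \<in> chambers" "D \<in> chambers" "s \<in> S" "\<delta> C D = s"
  shows "\<delta> D C = s"
proof -
  have c: "\<delta> D C \<in> carrier W" using assms delta_closed by simp
  have "\<one> \<in> {s \<otimes> \<delta> D C, \<delta> D C}"
    using delta_adjacent[OF assms(2) assms(1) assms(1) assms(3) assms(4)] assms(1)
    by (simp add: delta_self)
  moreover have "\<delta> D C \<noteq> \<one>"
    using delta_eq_one_iff[OF assms(2,1)] delta_self[OF assms(1)] assms gen_not_one[of s] by auto
  ultimately have "s \<otimes> \<delta> D C = s \<otimes> s" using assms(3) by simp
  then show ?thesis using assms(3) c by (metis gen_mult_cancel gen_closed)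
qed

lemma gallery_exists:
  "ws \<in> lists S \<Longrightarrow> C \<in> chambers \<Longrightarrow> D \<in> chambers \<Longrightarrow> \<delta> C D = word_prod W ws \<Longrightarrow> gallery ws C D"
proof (induction ws arbitrary: C)
  case Nil
  then show ?case by (simp add: delta_eq_one_iff)
next
  case (Cons s ws)
  then have s: "s \<in> S" "ws \<in> lists S" by auto
  from delta_adjacent_exists[OF Cons.prems(2,3) s(1)]
  obtain C' where C': "C' \<in> chambers" "\<delta> C' C = s" "\<delta> C' D = s \<otimes> \<delta> C D" by blast
  then have "\<delta> C' D = word_prod W ws" using Cons.prems(4) s by simp
  then show ?case using Cons.IH[OF s(2) C'(1) Cons.prems(3)] C' by auto
qed

lemma gallery_snoc:
  "D \<in> chambers \<Longrightarrow> \<delta> D E = s \<Longrightarrow> gallery ws C E \<Longrightarrow> gallery (ws @ [s]) C D"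
  by (induction ws arbitrary: C) auto

lemma gallery_rev:
  "ws \<in> lists S \<Longrightarrow> C \<in> chambers \<Longrightarrow> gallery ws C D \<Longrightarrow> gallery (rev ws) D C"
proof (induction ws arbitrary: C)
  case (Cons s ws)
  then obtain C' where C': "C' \<in> chambers" "\<delta> C' C = s" "gallery ws C' D" by auto
  have "gallery (rev ws) D C'" using Cons.IH Cons.prems C' by simp
  moreover have "\<delta> C C' = s" using delta_gen_sym[OF C'(1) Cons.prems(2) _ C'(2)] Cons.prems by simp
  ultimately show ?case using gallery_snoc[OF Cons.prems(2)] by simp
qed simp

text \<open>Along a reduced type every step raises the length, so axiom (2) determines each distance
  exactly.\<close>

lemma delta_reduced_gallery:
  "ws \<in> lists S \<Longrightarrow> length ws = len (word_prod W ws) \<Longrightarrow> C \<in> chambers \<Longrightarrow> D \<in> chambers \<Longrightarrow>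
    gallery ws C D \<Longrightarrow> \<delta> C D = word_prod W ws"
proof (induction ws arbitrary: C)
  case Nil
  then show ?case by (simp add: delta_self)
next
  case (Cons s ws)
  then obtain C' where C': "C' \<in> chambers" "\<delta> C' C = s" "gallery ws C' D" by auto
  have s: "s \<in> S" "ws \<in> lists S" using Cons.prems by auto
  have red: "length ws = len (word_prod W ws)"
    using len_le_length[OF s(2)] len_mult_le[of s "word_prod W ws"] s Cons.prems(2) len_gen[of s] by simp
  have IH: "\<delta> C' D = word_prod W ws" using Cons.IH[OF s(2) red C'(1) Cons.prems(4) C'(3)] .
  have "\<delta> C C' = s" using delta_gen_sym[OF C'(1) Cons.prems(3) s(1) C'(2)] .
  from delta_adjacent_up[OF C'(1) Cons.prems(4) Cons.prems(3) s(1) this]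
  show ?case using IH red Cons.prems(2) by simp
qed

text \<open>A reduced gallery read backwards has the reversed word as its type, which is again
  reduced and represents the inverse.\<close>

lemma delta_sym:
  assumes "C \<in> chambers" "D \<in> chambers"
  shows "\<delta> D C = inv (\<delta> C D)"
proof -
  obtain ws where ws: "ws \<in> lists S" "length ws = len (\<delta> C D)" "word_prod W ws = \<delta> C D"
    using delta_closed[OF assms] by (rule reduced_word)
  have rev: "rev ws \<in> lists S" "word_prod W (rev ws) = inv (\<delta> C D)"
    using ws by (auto simp: word_prod_rev)
  have "gallery (rev ws) D C" using gallery_rev gallery_exists ws assms by simp
  moreover have "length (rev ws) = len (word_prod W (rev ws))"
    using rev ws len_inv[OF delta_closed[OF assms]] by simp
  ultimately have "\<delta> D C = word_prod W (rev ws)"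
    using delta_reduced_gallery[OF rev(1)] assms by blast
  then show ?thesis using rev(2) by simp
qed

section \<open>Distances from and to the chambers of a panel\<close>

lemma delta_adjacent_right_up:
  assumes "C \<in> chambers" "D \<in> chambers" "D' \<in> chambers" "s \<in> S" "\<delta> D' D = s"
    and "len (\<delta> C D \<otimes> s) = len (\<delta> C D) + 1"
  shows "\<delta> C D' = \<delta> C D \<otimes> s"
proof -
  have c: "\<delta> C D \<in> carrier W" "\<delta> C D \<otimes> s \<in> carrier W" using assms delta_closed by simp_all
  note DC = delta_sym[OF assms(1,2)]
  have eq: "s \<otimes> \<delta> D C = inv (\<delta> C D \<otimes> s)" using c DC assms(4) by (simp add: inv_mult_group)
  then have "len (s \<otimes> \<delta> D C) = len (\<delta> D C) + 1" using assms(6) len_inv c DC by simp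
  then have "\<delta> D' C = inv (\<delta> C D \<otimes> s)"
    using delta_adjacent_up[OF assms(2,1,3-5)] eq by simp
  then show ?thesis using delta_sym[OF assms(3,1)] c(2) by simp
qed

text \<open>A panel has at most one chamber nearest to \<open>F\<close>: if \<open>D\<close> and
  \<open>E\<close> were both nearer than \<open>C\<close>, they would be \<open>s\<close>-adjacent,
  and the step from \<open>E\<close> to \<open>D\<close> would lengthen the distance.\<close>

lemma delta_not_both_down:
  assumes "C \<in> chambers" "D \<in> chambers" "E \<in> chambers" "F \<in> chambers" "D \<noteq> E" "s \<in> S"
    and adj: "\<delta> D C = s" "\<delta> E C = s" and down: "len (s \<otimes> \<delta> C F) < len (\<delta> C F)"
  shows "\<delta> D F = \<delta> C F \<or> \<delta> E F = \<delta> C F"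
proof (rule ccontr)
  assume neg: "\<not> ?thesis"
  have c: "\<delta> C F \<in> carrier W" using assms delta_closed by simp
  have D: "\<delta> D F = s \<otimes> \<delta> C F"
    using delta_adjacent[OF assms(1,4,2,6) adj(1)] neg by auto
  have E: "\<delta> E F = s \<otimes> \<delta> C F"
    using delta_adjacent[OF assms(1,4,3,6) adj(2)] neg by auto
  have "\<delta> C E = s" using delta_gen_sym assms by blast
  then have "\<delta> D E \<in> {s \<otimes> s, s}"
    using delta_adjacent[OF assms(1,3,2,6) adj(1)] by simp
  then have "\<delta> D E = s" using delta_eq_one_iff assms by auto
  moreover have "len (s \<otimes> \<delta> E F) = len (\<delta> E F) + 1"
    using assms(6) c down E by (cases rule: len_gen_mult_cases[OF assms(6) c]) auto
  ultimately have "\<delta> D F = s \<otimes> \<delta> E F" using delta_adjacent_up assms by blast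
  then show False using neg E c assms(6) by simp
qed

lemma delta_not_both_down_right:
  assumes "C \<in> chambers" "D \<in> chambers" "E \<in> chambers" "F \<in> chambers" "D \<noteq> E" "s \<in> S"
    and adj: "\<delta> D C = s" "\<delta> E C = s" and down: "len (\<delta> F C \<otimes> s) < len (\<delta> F C)"
  shows "\<delta> F D = \<delta> F C \<or> \<delta> F E = \<delta> F C"
proof -
  have c: "\<delta> F C \<in> carrier W" "\<delta> F C \<otimes> s \<in> carrier W" using assms delta_closed by simp_all
  have CF: "\<delta> C F = inv (\<delta> F C)" using delta_sym[OF assms(4,1)] .
  then have "s \<otimes> \<delta> C F = inv (\<delta> F C \<otimes> s)" using c assms(6) by (simp add: inv_mult_group)
  then have "len (s \<otimes> \<delta> C F) < len (\<delta> C F)" using len_inv c CF down by simp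
  from delta_not_both_down[OF assms(1-8) this] show ?thesis
    using delta_sym[OF assms(2,4)] delta_sym[OF assms(3,4)] delta_sym[OF assms(1,4)] by auto
qed

text \<open>Thickness supplies two further chambers \<open>D\<close>, \<open>E\<close> in the
  \<open>s\<close>-panel of \<open>C\<close>. If \<open>s\<close> lengthens \<open>w\<close>,
  neither may be displaced farther than \<open>C\<close>, and this forces
  \<open>s w = w t\<close>.\<close>

lemma descent_or_intertwine_at_max_displacement:
  assumes thick and bij: "bij_betw \<phi> chambers chambers" and \<sigma>: "\<sigma> \<in> system_automorphisms"
    and \<phi>: "\<And>C D. C \<in> chambers \<Longrightarrow> D \<in> chambers \<Longrightarrow> \<delta> (\<phi> C) (\<phi> D) = \<sigma> (\<delta> C D)"
    and C: "C \<in> chambers"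
    and max: "\<And>D. D \<in> chambers \<Longrightarrow> len (\<delta> D (\<phi> D)) \<le> len (\<delta> C (\<phi> C))"
    and s: "s \<in> S"
  shows "len (s \<otimes> \<delta> C (\<phi> C)) < len (\<delta> C (\<phi> C)) \<or>
    (len (\<delta> C (\<phi> C)) < len (s \<otimes> \<delta> C (\<phi> C)) \<and> s \<otimes> \<delta> C (\<phi> C) = \<delta> C (\<phi> C) \<otimes> \<sigma> s)"
proof -
  define w where "w = \<delta> C (\<phi> C)"
  define t where "t = \<sigma> s"
  have im: "\<phi> D \<in> chambers" if "D \<in> chambers" for D using bij that bij_betwE by blast
  have t: "t \<in> S" using \<sigma> s by (auto simp: system_automorphisms_def t_def)
  have w: "w \<in> carrier W" using delta_closed C im by (simp add: w_def)
  obtain D E where DE: "D \<in> chambers" "E \<in> chambers" "D \<noteq> E" "\<delta> C D = s" "\<delta> C E = s"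
    using \<open>thick\<close> C s unfolding thick_def adjacent_def by blast
  have adj: "\<delta> D C = s" "\<delta> E C = s" using DE C s delta_gen_sym by blast+
  then have adj': "\<delta> (\<phi> D) (\<phi> C) = t" "\<delta> (\<phi> E) (\<phi> C) = t" using \<phi> DE C t_def by auto
  have neq: "\<phi> D \<noteq> \<phi> E" using DE bij by (auto simp: bij_betw_def inj_on_def)
  note ch = C DE(1,2) im[OF C] im[OF DE(1)] im[OF DE(2)]
  have max': "len (\<delta> D (\<phi> D)) \<le> len w" "len (\<delta> E (\<phi> E)) \<le> len w"
    using max DE by (auto simp: w_def)
  \<comment> \<open>The assumption named \<open>down\<close> says that \<open>s\<close> lengthens
    \<open>w\<close>. If \<open>t\<close> shortened \<open>w\<close> on the right, the image of
    \<open>D\<close> or of \<open>E\<close> would still be at distance \<open>w\<close> from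
    \<open>C\<close>, and that chamber would have displacement \<open>s w\<close>.\<close>
  have up: "len (w \<otimes> t) = Suc (len w)" if down: "len (s \<otimes> w) = Suc (len w)"
  proof (cases rule: len_mult_gen_cases[OF t w])
    case 2
    have "\<delta> C (\<phi> D) = w \<or> \<delta> C (\<phi> E) = w"
      using delta_not_both_down_right[OF ch(4,5,6,1) neq t adj'] 2 by (simp add: w_def)
    then show ?thesis
    proof
      assume "\<delta> C (\<phi> D) = w"
      then have "\<delta> D (\<phi> D) = s \<otimes> w" using delta_adjacent_up[OF ch(1,5,2) s adj(1)] down by simp
      then show ?thesis using max' down by simp
    next
      assume "\<delta> C (\<phi> E) = w"
      then have "\<delta> E (\<phi> E) = s \<otimes> w" using delta_adjacent_up[OF ch(1,6,3) s adj(2)] down by simp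
      then show ?thesis using max' down by simp
    qed
  qed
  have "len (s \<otimes> w) < len w \<or> (len w < len (s \<otimes> w) \<and> s \<otimes> w = w \<otimes> t)"
  proof (cases rule: len_gen_mult_cases[OF s w])
    case 1
    have D: "\<delta> D (\<phi> C) = s \<otimes> w" using delta_adjacent_up[OF ch(1,4,2) s adj(1)] 1 by (simp add: w_def)
    have sw: "s \<otimes> w \<in> carrier W" using s w by simp
    \<comment> \<open>Otherwise \<open>D\<close> would be displaced by \<open>s w t\<close>, of
      length \<open>len w + 2\<close>.\<close>
    have down: "len (s \<otimes> w \<otimes> t) < len (s \<otimes> w)"
    proof (cases rule: len_mult_gen_cases[OF t sw])
      case u: 1
      then have "\<delta> D (\<phi> D) = s \<otimes> w \<otimes> t"
        using delta_adjacent_right_up[OF ch(2,4,5) t adj'(1)] D by simp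
      then show ?thesis using max' 1 u by simp
    qed simp
    obtain ws where ws: "ws \<in> lists S" "length ws = len w" "word_prod W ws = w"
      using w by (rule reduced_word)
    have t_list: "[t] \<in> lists S" using t by simp
    \<comment> \<open>Both \<open>s w\<close> and \<open>w t\<close> have length
      \<open>len w + 1\<close>, so \<open>s\<close> is a left descent of \<open>w t\<close>.
      Deleting a letter of \<open>w\<close> would shorten \<open>s w\<close>; hence the final
      \<open>t\<close> is deleted.\<close>
    have "len (s \<otimes> word_prod W ws \<otimes> word_prod W [t]) < len (word_prod W ws \<otimes> word_prod W [t])"
      using down 1 up[OF 1] ws(3) t by simp
    with ws(1) t_list s show ?thesis
    proof (cases rule: exchange_append)
      case (left i)
      then have "len (s \<otimes> w) < len w"
        using len_le_length[OF delete_nth_in_lists[OF ws(1)], of i] length_delete_nth[OF left(1)] ws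
        by simp
      then show ?thesis using 1 by simp
    next
      case (right i)
      then have "s \<otimes> w \<otimes> t = w" using ws(3) t w by (simp add: delete_nth_def)
      then have "s \<otimes> w = w \<otimes> t" using gen_mult_cancel_right[OF t sw] by simp
      then show ?thesis using 1 by simp
    qed
  qed simp
  then show ?thesis by (simp add: w_def t_def)
qed


lemma unbounded_displacement:
  assumes thick purely_infinite "automorphism \<phi>" "nontrivial \<phi>"
  shows "\<not> bdd_above {gallery_dist C (\<phi> C) | C. C \<in> chambers}"
proof
  let ?A = "{gallery_dist C (\<phi> C) | C. C \<in> chambers}"
  assume "bdd_above ?A"
  moreover have "?A \<noteq> {}" using chambers_nonempty by blast
  \<comment> \<open>A bounded set of naturals is finite, so the maximal displacement is
    attained.\<close>
  ultimately have "Max ?A \<in> ?A" and Max: "\<And>n. n \<in> ?A \<Longrightarrow> n \<le> Max ?A"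
    using Max_in[of ?A] Max_ge[of ?A] unfolding bdd_above_nat by blast+
  then obtain C where C: "C \<in> chambers" "gallery_dist C (\<phi> C) = Max ?A" by auto
  have max: "len (\<delta> D (\<phi> D)) \<le> len (\<delta> C (\<phi> C))" if "D \<in> chambers" for D
  proof -
    have "gallery_dist D (\<phi> D) \<le> gallery_dist C (\<phi> C)"
      unfolding C(2) using that by (intro Max) blast
    then show ?thesis by (simp only: gallery_dist_def)
  qed
  obtain \<sigma> where \<sigma>: "bij_betw \<phi> chambers chambers" "\<sigma> \<in> system_automorphisms"
    "\<And>C D. C \<in> chambers \<Longrightarrow> D \<in> chambers \<Longrightarrow> \<delta> (\<phi> C) (\<phi> D) = \<sigma> (\<delta> C D)"
    using assms(3) unfolding automorphism_def by blast
  have im: "\<phi> D \<in> chambers" if "D \<in> chambers" for D using \<sigma>(1) that bij_betwE by blast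
  let ?w = "\<delta> C (\<phi> C)"
  have "\<not> purely_infinite"
  proof (rule not_purely_infinite_if_descent_or_intertwine)
    show "?w \<in> carrier W" using delta_closed C(1) im by simp
    show "?w \<noteq> \<one>"
    proof
      assume "?w = \<one>"
      \<comment> \<open>Maximal displacement zero means that every chamber is fixed.\<close>
      then have "\<phi> D = D" if D: "D \<in> chambers" for D
        using max[OF D] len_eq_0_iff[OF delta_closed[OF D im[OF D]]] delta_eq_one_iff[OF D im[OF D]]
        by simp
      then show False using assms(4) by (auto simp: nontrivial_def)
    qed
    fix s assume s: "s \<in> S"
    have "\<sigma> s \<in> S" using \<sigma>(2) s by (auto simp: system_automorphisms_def)
    then show "len (s \<otimes> ?w) < len ?w \<or> (len ?w < len (s \<otimes> ?w) \<and> (\<exists>t \<in> S. s \<otimes> ?w = ?w \<otimes> t))"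
      using descent_or_intertwine_at_max_displacement[OF assms(1) \<sigma> C(1) max s] by blast
  qed
  then show False using assms(2) by contradiction
qed

end

theorem theorem3p2:
  fixes W :: "('w, 'm) monoid_scheme" and S :: "'w set"
    and chambers :: "'c set" and \<delta> :: "'c \<Rightarrow> 'c \<Rightarrow> 'w" and \<phi> :: "'c \<Rightarrow> 'c"
  assumes "building W S chambers \<delta>"
    and "building.thick S chambers \<delta>"
    and "coxeter_system.purely_infinite W S"
    and "building.automorphism W S chambers \<delta> \<phi>"
    and "building.nontrivial chambers \<phi>"
  shows "\<not> bdd_above {building.gallery_dist W S \<delta> C (\<phi> C) | C. C \<in> chambers}"
  using building.unbounded_displacement[OF assms] .

end
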